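(* Let $K\subset\mathbb R^n$ be a minimal covering body with respect to a full-rank lattice $\Lambda\subset\mathbb R^n$. If $\mathbf x$ is a vertex of $K$ and $\mathbf x+\mathbf z\in\operatorname{bd}K$ for some $\mathbf z\in\Lambda\setminus\{\mathbf 0\}$, then $$\mathrm{cone}_K(\mathbf x)\not\subseteq\mathrm{cone}_K(\mathbf x+\mathbf z).$$
   Context: A convex body in $\mathbb R^n$ is a compact convex set with nonempty interior. A convex body $K$ is a minimal covering body with respect to a full-rank lattice $\Lambda$ if $K+\Lambda=\mathbb R^n$ and no proper convex subbody $K'\subsetneq K$ (i.e. no convex body properly contained in $K$) satisfies $K'+\Lambda=\mathbb R^n$. Every minimal covering body is a polytope, and "vertex" means vertex of this polytope. $\operatorname{bd}K$ is the boundary of $K$. For $\mathbf x\in\operatorname{bd}K$, the supporting cone (tangent cone) of $K$ at $\mathbf x$ is $$\mathrm{cone}_K(\mathbf x)=\operatorname{cl}\{\alpha(\mathbf y-\mathbf x):\mathbf y\in K,\ \alpha\ge0\},$$ where $\operatorname{cl}$ denotes closure. *)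

theory Defs
  imports "HOL-Analysis.Analysis"
begin

(* An independent subset of R^n is finite, so the sum over B never degenerates. *)
definition full_rank_lattice :: "(real ^ 'n) set \<Rightarrow> bool" where
  "full_rank_lattice L \<longleftrightarrow>
     (\<exists>B. independent B \<and> span B = UNIV \<and>
          L = {\<Sum>b\<in>B. of_int (c b) *\<^sub>R b | c :: real ^ 'n \<Rightarrow> int. True})"

definition convex_body :: "(real ^ 'n) set \<Rightarrow> bool" where
  "convex_body K \<longleftrightarrow> compact K \<and> convex K \<and> interior K \<noteq> {}"

(* K + L is the Minkowski sum of HOL-Library.Set_Algebras. *)
definition minimal_covering_body :: "(real ^ 'n) set \<Rightarrow> (real ^ 'n) set \<Rightarrow> bool" where
  "minimal_covering_body L K \<longleftrightarrow>
     convex_body K \<and> K + L = UNIV \<and>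
     (\<forall>K'. convex_body K' \<and> K' \<subset> K \<longrightarrow> K' + L \<noteq> UNIV)"

(* The closed tangent cone, translated to have its apex at the origin; meant for x in frontier K. *)
definition supporting_cone :: "(real ^ 'n) set \<Rightarrow> real ^ 'n \<Rightarrow> (real ^ 'n) set" where
  "supporting_cone K x = closure {\<alpha> *\<^sub>R (y - x) | \<alpha> y. y \<in> K \<and> \<alpha> \<ge> 0}"

end

theory Submission
  imports Defs
begin

text \<open>
  Call a point \<open>p\<close> of \<open>K\<close> \<^emph>\<open>uncovered\<close> if no translate \<open>K - z\<close> with \<open>z \<in> L - {0}\<close> contains
  it.  Minimality forces uncovered points arbitrarily close to each extreme point \<open>x\<close>
  (\<open>uncovered_point_near_extreme_point\<close>): otherwise a small cap of \<open>K\<close> around \<open>x\<close> could be cut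
  off without losing the covering property.

  Suppose that the cone at \<open>x\<close> lies in the cone at \<open>x + z\<close>.  For an uncovered \<open>p\<close> close to \<open>x\<close>,
  the short vector \<open>p - x\<close> lies in the cone at \<open>x\<close>, hence in the cone at \<open>x + z\<close>.  If \<open>K\<close>
  coincides with its tangent cone near \<open>x + z\<close>, then \<open>(x + z) + (p - x) = p + z\<close> lies in
  \<open>K\<close>, which contradicts the choice of \<open>p\<close>.

  It is polyhedrality that makes \<open>K\<close> coincide locally with its tangent cones
  (\<open>polyhedron_locally_contains_supporting_cone\<close>), so it remains to see that \<open>K\<close> is a polytope,
  that is, that its extreme points do not accumulate at any \<open>w \<in> K\<close>
  (\<open>extreme_points_do_not_accumulate\<close>).  Near \<open>w\<close>, every translate \<open>K - z\<close> that occurs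
  contains \<open>w\<close> itself.  Let \<open>p\<close> be uncovered near an extreme point \<open>v \<noteq> w\<close> close to \<open>w\<close>, and move
  away from \<open>w\<close> along the ray from \<open>w\<close> through \<open>p\<close>.  If this ray left \<open>K\<close> close to \<open>w\<close>, it
  would enter some \<open>K - z\<close>, and by convexity that translate would contain the whole segment back
  to \<open>w\<close>, including \<open>p\<close>.  So the ray stays in \<open>K\<close> for a while, and in the limit \<open>p \<rightarrow> v\<close> the
  point \<open>v\<close> is interior to a segment in \<open>K\<close>, so it is not extreme.
\<close>

section \<open>Full-rank lattices\<close>

lemma full_rank_lattice_zero:
  fixes L :: "(real ^ 'n) set"
  assumes "full_rank_lattice L"
  shows "0 \<in> L"
proof -
  obtain B where L: "L = {\<Sum>b\<in>B. of_int (c b) *\<^sub>R b | c :: real ^ 'n \<Rightarrow> int. True}"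
    using assms unfolding full_rank_lattice_def by blast
  show ?thesis unfolding L by (auto intro!: exI[of _ "\<lambda>_. 0"])
qed

lemma full_rank_lattice_diff:
  fixes L :: "(real ^ 'n) set"
  assumes "full_rank_lattice L" "u \<in> L" "v \<in> L"
  shows "u - v \<in> L"
proof -
  obtain B where L: "L = {\<Sum>b\<in>B. of_int (c b) *\<^sub>R b | c :: real ^ 'n \<Rightarrow> int. True}"
    using assms unfolding full_rank_lattice_def by blast
  obtain c d where "u = (\<Sum>b\<in>B. of_int (c b) *\<^sub>R b)" "v = (\<Sum>b\<in>B. of_int (d b) *\<^sub>R b)"
    using assms(2,3) unfolding L by blast
  then have "u - v = (\<Sum>b\<in>B. of_int (c b - d b) *\<^sub>R b)"
    by (simp add: sum_subtractf scaleR_diff_left)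
  then show ?thesis unfolding L by (intro CollectI exI[of _ "\<lambda>b. c b - d b"]) simp
qed

text \<open>
  The coordinates with respect to a basis are linear, hence bounded, functions of the vector, so
  that a bounded set leaves only finitely many integer values for each coordinate.
\<close>

lemma full_rank_lattice_finite_bounded:
  fixes L :: "(real ^ 'n) set"
  assumes "full_rank_lattice L"
  shows "finite {z \<in> L. norm z \<le> R}"
proof -
  obtain B where B: "independent B" "span B = UNIV"
    and L: "L = {\<Sum>b\<in>B. of_int (c b) *\<^sub>R b | c :: real ^ 'n \<Rightarrow> int. True}"
    using assms unfolding full_rank_lattice_def by blast
  have finB: "finite B" using B(1) by (rule independent_imp_finite)
  have lin: "linear (\<lambda>v. representation B v b)" for b
    using B by (intro linearI) (simp_all add: representation_add representation_scale)
  have "\<exists>M. \<forall>v. \<bar>representation B v b\<bar> \<le> M * norm v" for b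
    using linear_bounded[OF lin[of b]] by simp
  then obtain M where M: "\<And>b v. \<bar>representation B v b\<bar> \<le> M b * norm v"
    by metis
  define C where "C b = {- \<lceil>M b * \<bar>R\<bar>\<rceil> .. \<lceil>M b * \<bar>R\<bar>\<rceil>}" for b
  have "{z \<in> L. norm z \<le> R} \<subseteq> (\<lambda>c. \<Sum>b\<in>B. of_int (c b) *\<^sub>R b) ` (PiE B C)"
  proof
    fix z assume "z \<in> {z \<in> L. norm z \<le> R}"
    then obtain c :: "real ^ 'n \<Rightarrow> int"
      where z: "z = (\<Sum>b\<in>B. of_int (c b) *\<^sub>R b)" "norm z \<le> R"
      unfolding L by blast
    have "c b \<in> C b" if "b \<in> B" for b
    proof -
      have "representation B z b = (\<Sum>a\<in>B. of_int (c a) * representation B a b)"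
        unfolding z(1) by (simp add: linear_sum[OF lin] linear_cmul[OF lin])
      also have "\<dots> = (\<Sum>a\<in>B. if a = b then of_int (c a) else 0)"
        using B(1) by (intro sum.cong refl) (simp add: representation_basis)
      also have "\<dots> = of_int (c b)" using finB that by simp
      finally have rep: "representation B z b = of_int (c b)" .
      have "0 \<le> M b"
        using M[where b = b and v = "axis undefined 1"] by (simp add: norm_axis_1)
      then have "M b * norm z \<le> M b * \<bar>R\<bar>" using z(2) by (intro mult_left_mono) auto
      then have "\<bar>of_int (c b)\<bar> \<le> M b * \<bar>R\<bar>"
        using M[of z b] by (simp add: rep)
      then show ?thesis unfolding C_def by (simp add: abs_le_iff) linarith
    qed
    then have "restrict c B \<in> PiE B C" by simp
    moreover have "z = (\<Sum>b\<in>B. of_int (restrict c B b) *\<^sub>R b)" unfolding z(1) by simp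
    ultimately show "z \<in> (\<lambda>c. \<Sum>b\<in>B. of_int (c b) *\<^sub>R b) ` (PiE B C)" by blast
  qed
  moreover have "finite (PiE B C)" using finB by (intro finite_PiE) (auto simp: C_def)
  ultimately show ?thesis by (meson finite_surj)
qed

lemma full_rank_lattice_norm_lower_bound:
  fixes L :: "(real ^ 'n) set"
  assumes "full_rank_lattice L"
  obtains e where "e > 0" "\<And>z. z \<in> L - {0} \<Longrightarrow> e \<le> norm z"
proof -
  let ?S = "{z \<in> L. norm z \<le> 1} - {0}"
  have fin: "finite (insert 1 (norm ` ?S))"
    using full_rank_lattice_finite_bounded[OF assms] by simp
  let ?e = "Min (insert 1 (norm ` ?S))"
  have "?e > 0" using fin by (subst Min_gr_iff) auto
  moreover have "?e \<le> norm z" if "z \<in> L - {0}" for z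
  proof (cases "norm z \<le> 1")
    case True
    then show ?thesis using that fin by (intro Min_le) auto
  next
    case False
    moreover have "?e \<le> 1" using fin by (intro Min_le) auto
    ultimately show ?thesis by linarith
  qed
  ultimately show ?thesis using that by blast
qed

text \<open>
  Only finitely many translates of a compact set come near a given point, and those that miss
  the point stay away from it because they are closed.
\<close>

lemma lattice_translates_near_point:
  fixes K L :: "(real ^ 'n) set"
  assumes "full_rank_lattice L" "compact K"
  shows "\<forall>\<^sub>F y in nhds w. \<forall>z\<in>L. y + z \<in> K \<longrightarrow> w + z \<in> K"
proof -
  obtain M where M: "\<And>k. k \<in> K \<Longrightarrow> norm k \<le> M"
    using compact_imp_bounded[OF assms(2)] by (auto simp: bounded_iff)
  let ?Z = "{z \<in> L. norm z \<le> M + norm w + 1}"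
  have "\<forall>\<^sub>F y in nhds w. y + z \<in> K \<longrightarrow> w + z \<in> K" for z
  proof (cases "w + z \<in> K")
    case False
    have "((\<lambda>y. y + z) \<longlongrightarrow> w + z) (nhds w)"
      by (intro tendsto_intros filterlim_ident)
    then have "\<forall>\<^sub>F y in nhds w. y + z \<in> - K"
      using False assms(2) by (intro topological_tendstoD) (auto simp: compact_imp_closed open_Compl)
    then show ?thesis by eventually_elim auto
  qed simp
  then have "\<forall>\<^sub>F y in nhds w. \<forall>z\<in>?Z. y + z \<in> K \<longrightarrow> w + z \<in> K"
    by (intro eventually_ball_finite full_rank_lattice_finite_bounded assms) auto
  moreover have "\<forall>\<^sub>F y in nhds w. dist y w < 1"
    by (auto simp: eventually_nhds_metric intro: exI[of _ 1])
  ultimately show ?thesis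
  proof eventually_elim
    case (elim y)
    have "z \<in> ?Z" if "z \<in> L" "y + z \<in> K" for z
    proof -
      have "norm z \<le> norm (y + z) + norm (w - y) + norm w" by norm
      then show ?thesis using M[OF that(2)] that(1) elim(2) by (simp add: dist_norm norm_minus_commute)
    qed
    then show ?case using elim(1) by blast
  qed
qed

section \<open>Uncovered points and polytopality\<close>

lemma covering_obtain:
  fixes K L :: "(real ^ 'n) set"
  assumes "full_rank_lattice L" "K + L = UNIV"
  obtains z where "z \<in> L" "q + z \<in> K"
proof -
  obtain k l where kl: "q = k + l" "k \<in> K" "l \<in> L"
    using assms(2) set_plus_elim[of q K L] by auto
  have "- l \<in> L"
    using full_rank_lattice_diff[OF assms(1) full_rank_lattice_zero[OF assms(1)] kl(3)] by simp
  then show ?thesis using kl that[of "- l"] by simp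
qed

text \<open>
  The body \<open>K\<close> without a cap is the convex hull of \<open>K - ball x e\<close>: extremality of \<open>x\<close> keeps
  \<open>x\<close> outside of it.  It does not cover, and a point witnessing this has its representative in the
  cap; another translate could only reach that point through the cap, but the cap is too small to
  contain two points that differ by a lattice vector.
\<close>

lemma uncovered_point_near_extreme_point:
  fixes K L :: "(real ^ 'n) set"
  assumes lat: "full_rank_lattice L" and min: "minimal_covering_body L K"
    and x: "x extreme_point_of K" and "e > 0"
  obtains p where "p \<in> K" "dist x p < e" "\<And>z. z \<in> L - {0} \<Longrightarrow> p + z \<notin> K"
proof -
  have K: "compact K" "convex K" "interior K \<noteq> {}" "K + L = UNIV"
    using min by (auto simp: minimal_covering_body_def convex_body_def)
  obtain g where g: "g > 0" "\<And>z. z \<in> L - {0} \<Longrightarrow> g \<le> norm z"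
    using full_rank_lattice_norm_lower_bound[OF lat] by blast
  have "interior K \<noteq> {x}" using not_open_singleton[of x] open_interior[of K] by metis
  then obtain u where u: "u \<in> interior K" "u \<noteq> x" using K(3) by blast
  \<comment> \<open>The bound by \<open>dist x u\<close> keeps an interior point of \<open>K\<close> out of the cap.\<close>
  define d where "d = min e (min (g / 2) (dist x u / 2))"
  have d: "d > 0" "d \<le> e" "2 * d \<le> g" "d < dist x u"
    using \<open>e > 0\<close> g(1) u(2) unfolding d_def by (auto simp: min_less_iff_disj)
  define K' where "K' = convex hull (K - ball x d)"
  have "K - ball x d \<subseteq> K - {x}" using d(1) by auto
  moreover have "convex (K - {x})" using x K(2) by (simp add: extreme_point_of_stillconvex)
  ultimately have sub: "K' \<subseteq> K - {x}" unfolding K'_def by (rule hull_minimal)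
  have cap: "K - K' \<subseteq> ball x d"
    using hull_subset[of "K - ball x d" convex] unfolding K'_def by blast
  have "interior K - cball x d \<subseteq> K'"
    using interior_subset[of K] hull_subset[of "K - ball x d" convex] unfolding K'_def by force
  then have "interior K - cball x d \<subseteq> interior K'"
    by (intro interior_maximal open_Diff) auto
  then have "interior K' \<noteq> {}" using u d(4) by (auto simp: mem_cball)
  then have "convex_body K'" using K(1)
    unfolding convex_body_def K'_def by (simp add: compact_convex_hull compact_diff)
  moreover have "x \<in> K" using x by (simp add: extreme_point_of_def)
  ultimately have "K' + L \<noteq> UNIV"
    using min sub unfolding minimal_covering_body_def by blast
  then obtain q where q: "q \<notin> K' + L" by blast
  obtain l where l: "l \<in> L" "q + l \<in> K" using covering_obtain[OF lat K(4)] by blast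
  have notK': "q + l' \<notin> K'" if "l' \<in> L" for l'
  proof
    assume "q + l' \<in> K'"
    moreover have "- l' \<in> L"
      using full_rank_lattice_diff[OF lat full_rank_lattice_zero[OF lat] that] by simp
    ultimately have "(q + l') + - l' \<in> K' + L" by (rule set_plus_intro)
    then show False using q by simp
  qed
  show ?thesis
  proof (rule that)
    show "q + l \<in> K" by (rule l)
    have near: "dist x (q + l) < d" using notK'[OF l(1)] l(2) cap by auto
    then show "dist x (q + l) < e" using d by linarith
    fix z assume z: "z \<in> L - {0}"
    show "q + l + z \<notin> K"
    proof
      assume "q + l + z \<in> K"
      moreover have "l + z \<in> L"
      proof -
        have "- z \<in> L"
          using full_rank_lattice_diff[OF lat full_rank_lattice_zero[OF lat]] z by fastforce
        then show ?thesis using full_rank_lattice_diff[OF lat l(1)] by fastforce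
      qed
      ultimately have "dist x (q + l + z) < d"
        using notK'[of "l + z"] cap by (auto simp: add.assoc)
      moreover have "norm z \<le> dist x (q + l) + dist x (q + l + z)"
        using dist_triangle3[of "q + l" "q + l + z" x] by (simp add: dist_norm)
      ultimately show False using near d(3) g(2)[OF z] by linarith
    qed
  qed
qed

text \<open>
  The point beyond an extreme point \<open>v\<close> on the ray from \<open>w\<close> cannot be shown to lie in \<open>K\<close> directly,
  as \<open>v\<close> itself may be covered by other translates.  The covering argument therefore runs along the
  ray through a nearby uncovered point, and closedness of \<open>K\<close> transfers it to \<open>v\<close>.
\<close>

lemma extreme_points_do_not_accumulate:
  fixes K L :: "(real ^ 'n) set"
  assumes lat: "full_rank_lattice L" and min: "minimal_covering_body L K" and w: "w \<in> K"
  obtains r where "r > 0" "\<And>v. v extreme_point_of K \<Longrightarrow> dist v w < r \<Longrightarrow> v = w"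
proof -
  have K: "compact K" "convex K" "K + L = UNIV"
    using min by (auto simp: minimal_covering_body_def convex_body_def)
  obtain r where r: "r > 0"
    and nearby: "\<And>y z. dist y w < r \<Longrightarrow> z \<in> L \<Longrightarrow> y + z \<in> K \<Longrightarrow> w + z \<in> K"
    using lattice_translates_near_point[OF lat K(1), of w]
    unfolding eventually_nhds_metric by blast
  have "v = w" if v: "v extreme_point_of K" "dist v w < r" for v
  proof (rule ccontr)
    assume "v \<noteq> w"
    then have "1 < r / dist v w" using v(2) by simp
    then obtain t where t: "1 < t" "t < r / dist v w" using dense by blast
    \<comment> \<open>This homothety carries \<open>p\<close> outward along its ray from \<open>w\<close>, far enough that \<open>v\<close> lies
      strictly between \<open>w\<close> and its image, but not out of the ball of radius \<open>r\<close>.\<close>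
    define f where "f p = w + t *\<^sub>R (p - w)" for p
    have "dist (f v) w = t * dist v w" using t(1) by (simp add: f_def dist_norm)
    then have fnear: "dist (f v) w < r"
      using t(2) \<open>v \<noteq> w\<close> by (simp add: pos_less_divide_eq)
    have between: "p + a = (1 - 1 / t) *\<^sub>R (w + a) + (1 / t) *\<^sub>R (f p + a)" for p a
    proof -
      have "f p + a = (w + a) + t *\<^sub>R (p - w)" by (simp add: f_def)
      then have "(1 / t) *\<^sub>R (f p + a) = (1 / t) *\<^sub>R (w + a) + (p - w)"
        using t(1) by (simp only: scaleR_add_right scaleR_scaleR) simp
      moreover have "(1 - 1 / t) *\<^sub>R (w + a) = (w + a) - (1 / t) *\<^sub>R (w + a)"
        by (simp only: scaleR_diff_left scaleR_one)
      ultimately show ?thesis by simp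
    qed
    have "f v \<in> K"
    proof (rule ccontr)
      assume "f v \<notin> K"
      then have "f v \<in> - K \<inter> ball w r" using fnear by (simp add: dist_commute)
      moreover have "open (- K \<inter> ball w r)"
        using K(1) by (simp add: compact_imp_closed open_Compl open_Int)
      moreover have "(f \<longlongrightarrow> f v) (nhds v)"
        unfolding f_def by (intro tendsto_intros filterlim_ident)
      ultimately have "\<forall>\<^sub>F p in nhds v. f p \<in> - K \<inter> ball w r"
        by (blast intro: topological_tendstoD)
      then obtain e where e: "e > 0" "\<And>p. dist p v < e \<Longrightarrow> f p \<in> - K \<inter> ball w r"
        unfolding eventually_nhds_metric by blast
      obtain p where p: "p \<in> K" "dist v p < e" "\<And>z. z \<in> L - {0} \<Longrightarrow> p + z \<notin> K"
        using uncovered_point_near_extreme_point[OF lat min v(1) e(1)] by blast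
      have fp: "f p \<notin> K" "dist (f p) w < r" using e(2)[of p] p(2) by (auto simp: dist_commute)
      obtain z where z: "z \<in> L" "f p + z \<in> K" using covering_obtain[OF lat K(3)] by blast
      have "w + z \<in> K" using nearby fp(2) z by blast
      moreover have "0 \<le> 1 - 1 / t" "0 \<le> 1 / t" using t(1) by auto
      ultimately have "(1 - 1 / t) *\<^sub>R (w + z) + (1 / t) *\<^sub>R (f p + z) \<in> K"
        using z(2) by (intro convexD[OF K(2)]) simp_all
      then have "p + z \<in> K" by (subst between[of p z])
      moreover have "z \<noteq> 0" using z(2) fp(1) by auto
      ultimately show False using p(3) z(1) by blast
    qed
    moreover have "v \<in> open_segment w (f v)"
    proof -
      have "w \<noteq> f v" using t(1) \<open>v \<noteq> w\<close> by (simp add: f_def)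
      moreover have "v = (1 - 1 / t) *\<^sub>R w + (1 / t) *\<^sub>R f v" using between[of v 0] unfolding add_0_right .
      moreover have "0 < 1 / t" "1 / t < 1" using t(1) by auto
      ultimately show ?thesis unfolding in_segment by blast
    qed
    ultimately show False using v(1) w by (auto simp: extreme_point_of_def)
  qed
  then show ?thesis using r that by blast
qed

lemma minimal_covering_body_imp_polytope:
  fixes K L :: "(real ^ 'n) set"
  assumes lat: "full_rank_lattice L" and min: "minimal_covering_body L K"
  shows "polytope K"
proof -
  have K: "compact K" "convex K"
    using min by (auto simp: minimal_covering_body_def convex_body_def)
  let ?E = "{v. v extreme_point_of K}"
  have "finite ?E"
  proof (rule ccontr)
    assume inf: "infinite ?E"
    have "?E \<subseteq> K" by (auto simp: extreme_point_of_def)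
    then obtain w where w: "w \<in> K" "w islimpt ?E"
      using K(1) inf unfolding compact_eq_Bolzano_Weierstrass by blast
    obtain r where "r > 0" "\<And>v. v extreme_point_of K \<Longrightarrow> dist v w < r \<Longrightarrow> v = w"
      using extreme_points_do_not_accumulate[OF lat min w(1)] by blast
    then show False using w(2) unfolding islimpt_approachable by blast
  qed
  then show ?thesis using Krein_Milman_Minkowski[OF K] unfolding polytope_def by blast
qed

section \<open>Supporting cones\<close>

lemma diff_in_supporting_cone:
  assumes "y \<in> K"
  shows "y - x \<in> supporting_cone K x"
proof -
  have "1 *\<^sub>R (y - x) \<in> {\<alpha> *\<^sub>R (y - x) | \<alpha> y. y \<in> K \<and> \<alpha> \<ge> 0}"
    using assms by (intro CollectI exI[of _ 1] exI[of _ y]) auto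
  then show ?thesis unfolding supporting_cone_def using closure_subset by force
qed

text \<open>
  It suffices to treat each of the finitely many half-spaces \<open>{y. a \<bullet> y \<le> b}\<close>: either its bound is
  strict at \<open>w\<close>, and then it stays so nearby, or the bounding hyperplane passes through \<open>w\<close>, and
  then every direction \<open>c\<close> of the cone satisfies \<open>a \<bullet> c \<le> 0\<close>.
\<close>

lemma polyhedron_locally_contains_supporting_cone:
  fixes K :: "(real ^ 'n) set"
  assumes "polyhedron K" "w \<in> K"
  shows "\<forall>\<^sub>F c in nhds 0. c \<in> supporting_cone K w \<longrightarrow> w + c \<in> K"
proof -
  obtain H where H: "finite H" "K = \<Inter>H" "\<forall>h\<in>H. \<exists>a b. a \<noteq> 0 \<and> h = {y. a \<bullet> y \<le> b}"
    using assms(1) unfolding polyhedron_def by blast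
  have "\<forall>\<^sub>F c in nhds 0. c \<in> supporting_cone K w \<longrightarrow> w + c \<in> h" if "h \<in> H" for h
  proof -
    have "\<exists>a b. a \<noteq> 0 \<and> h = {y. a \<bullet> y \<le> b}" using H(3) that by (rule bspec)
    then obtain a b where h: "h = {y. a \<bullet> y \<le> b}" by (elim exE conjE)
    have Kh: "a \<bullet> y \<le> b" if "y \<in> K" for y
    proof -
      have "y \<in> h" using that \<open>h \<in> H\<close> H(2) by auto
      then show ?thesis by (simp add: h)
    qed
    show ?thesis
    proof (cases "a \<bullet> w < b")
      case True
      have "((\<lambda>c. a \<bullet> (w + c)) \<longlongrightarrow> a \<bullet> (w + 0)) (nhds 0)"
        by (intro tendsto_intros filterlim_ident)
      then have "\<forall>\<^sub>F c in nhds 0. a \<bullet> (w + c) < b" using True by (intro order_tendstoD) auto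
      then show ?thesis unfolding h by eventually_elim auto
    next
      case False
      then have eq: "a \<bullet> w = b" using Kh[OF assms(2)] by simp
      have "supporting_cone K w \<subseteq> {c. a \<bullet> c \<le> 0}"
        unfolding supporting_cone_def
      proof (rule closure_minimal)
        show "{\<alpha> *\<^sub>R (y - w) | \<alpha> y. y \<in> K \<and> \<alpha> \<ge> 0} \<subseteq> {c. a \<bullet> c \<le> 0}"
          using Kh eq by (auto simp: inner_diff_right intro!: mult_nonneg_nonpos)
      qed (rule closed_halfspace_le)
      then show ?thesis unfolding h using eq by (auto simp: inner_add_right intro!: always_eventually)
    qed
  qed
  then have "\<forall>\<^sub>F c in nhds 0. \<forall>h\<in>H. c \<in> supporting_cone K w \<longrightarrow> w + c \<in> h"
    using H(1) by (intro eventually_ball_finite) auto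
  then show ?thesis unfolding H(2) by eventually_elim auto
qed

theorem lemma3p7:
  fixes K L :: "(real ^ 'n) set" and x z :: "real ^ 'n"
  assumes "full_rank_lattice L"
    and "minimal_covering_body L K"
    and "x extreme_point_of K"
    and "z \<in> L - {0}"
    and "x + z \<in> frontier K"
  shows "\<not> supporting_cone K x \<subseteq> supporting_cone K (x + z)"
proof
  assume sub: "supporting_cone K x \<subseteq> supporting_cone K (x + z)"
  have "closed K"
    using assms(2) by (auto simp: minimal_covering_body_def convex_body_def compact_imp_closed)
  then have xz: "x + z \<in> K" using assms(5) frontier_subset_closed by blast
  have "polyhedron K"
    using minimal_covering_body_imp_polytope[OF assms(1,2)] by (rule polytope_imp_polyhedron)
  from polyhedron_locally_contains_supporting_cone[OF this xz]
  obtain r where r: "r > 0"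
    "\<And>c. dist c 0 < r \<Longrightarrow> c \<in> supporting_cone K (x + z) \<Longrightarrow> x + z + c \<in> K"
    unfolding eventually_nhds_metric by blast
  obtain p where p: "p \<in> K" "dist x p < r" "\<And>l. l \<in> L - {0} \<Longrightarrow> p + l \<notin> K"
    using uncovered_point_near_extreme_point[OF assms(1-3) r(1)] by blast
  have "p - x \<in> supporting_cone K (x + z)" using diff_in_supporting_cone[OF p(1)] sub by blast
  then have "x + z + (p - x) \<in> K"
    using r(2)[of "p - x"] p(2) by (simp add: dist_norm norm_minus_commute)
  then have "p + z \<in> K" by (simp add: algebra_simps)
  then show False using p(3)[OF assms(4)] by blast
qed

end
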